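(* For $n \in \mathbb{N}$ let $\mathcal{A}_n$ be the set of all real matrices $A \in \mathbb{R}^{n \times n}$ whose rows $a_1, \dots, a_n \in \mathbb{R}^n$ satisfy $\|a_i\|_{\ell^2} \leq 1$ for all $1 \leq i \leq n$. Then, as $n \rightarrow \infty$, $$\max_{A \in \mathcal{A}_n} \frac{1}{2^{n}}\sum_{x \in \{-1,1\}^n} \|Ax\|_{\ell^{\infty}} = (1+o(1)) \cdot \sqrt{2\log n}.$$
   Context: Here $\log$ is the natural logarithm, $\|v\|_{\ell^2}$ is the Euclidean norm and $\|v\|_{\ell^\infty} = \max_i |v_i|$ for $v \in \mathbb{R}^n$. The statement means that the ratio of the left-hand side to $\sqrt{2 \log n}$ tends to $1$ as $n \to \infty$. *)

theory Defs
  imports "Jordan_Normal_Form.Matrix" "HOL-Analysis.L2_Norm"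
begin

text \<open>The dimension \<open>n\<close> varies inside the statement (it tends to infinity), so vectors and
  matrices are those with explicit carriers, indexed by \<open>0, \<dots>, n - 1\<close>.\<close>

definition l2_norm :: "real vec \<Rightarrow> real" where
  "l2_norm v = L2_set (\<lambda>i. v $ i) {..<dim_vec v}"

text \<open>Only meaningful for vectors of positive dimension: \<open>Max {}\<close> is unspecified.\<close>

definition linf_norm :: "real vec \<Rightarrow> real" where
  "linf_norm v = Max ((\<lambda>i. \<bar>v $ i\<bar>) ` {..<dim_vec v})"

definition row_bounded_mats :: "nat \<Rightarrow> real mat set" where
  "row_bounded_mats n = {A \<in> carrier_mat n n. \<forall>i<n. l2_norm (row A i) \<le> 1}"

definition sign_vecs :: "nat \<Rightarrow> real vec set" where
  "sign_vecs n = {x \<in> carrier_vec n. \<forall>i<n. x $ i \<in> {-1, 1}}"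

definition mean_linf_norm :: "nat \<Rightarrow> real mat \<Rightarrow> real" where
  "mean_linf_norm n A = 1 / 2 ^ n * (\<Sum>x\<in>sign_vecs n. linf_norm (A *\<^sub>v x))"

text \<open>The sum above really ranges over a finite set, with \<open>2 ^ n\<close> elements.\<close>

lemma bij_betw_sign_vecs: "bij_betw (vec n) ({..<n} \<rightarrow>\<^sub>E {-1, 1}) (sign_vecs n)"
proof (rule bij_betwI[where g = "\<lambda>x. restrict (\<lambda>i. x $ i) {..<n}"])
  show "vec n \<in> ({..<n} \<rightarrow>\<^sub>E {-1, 1}) \<rightarrow> sign_vecs n"
    by (force simp: sign_vecs_def PiE_iff)
  show "(\<lambda>x. restrict (\<lambda>i. x $ i) {..<n}) \<in> sign_vecs n \<rightarrow> ({..<n} \<rightarrow>\<^sub>E {-1, 1})"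
    by (auto simp: sign_vecs_def)
  show "restrict (\<lambda>i. vec n f $ i) {..<n} = f" if "f \<in> {..<n} \<rightarrow>\<^sub>E {-1, 1}" for f :: "nat \<Rightarrow> real"
    using that by (auto simp: fun_eq_iff restrict_def PiE_iff extensional_def)
  show "vec n (restrict (\<lambda>i. x $ i) {..<n}) = x" if "x \<in> sign_vecs n" for x
    using that by (auto simp: sign_vecs_def)
qed

lemma finite_sign_vecs: "finite (sign_vecs n)"
  using bij_betw_finite[OF bij_betw_sign_vecs, of n] by (simp add: finite_PiE)

lemma card_sign_vecs: "card (sign_vecs n) = 2 ^ n"
  using bij_betw_same_card[OF bij_betw_sign_vecs, of n] by (simp add: card_PiE numeral_2_eq_2)

end

theory Submission
  imports Defs "HOL-Analysis.Function_Topology" "HOL-Real_Asymp.Real_Asymp"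
begin

text \<open>For a uniformly random sign vector \<open>x\<close>, an entry of \<open>A x\<close> is a sign sum with weights of Euclidean norm
  at most 1, hence sub-Gaussian. The largest of \<open>n\<close> such variables in absolute value has mean at most
  \<open>sqrt (2 * ln (2 * n))\<close>, whatever their dependence; this is \<open>mean_linf_norm_upper\<close>, by exponential moments
  and \<open>cosh x \<le> exp (x\<^sup>2 / 2)\<close>.

  A matrix attaining this asymptotically only has to produce almost \<open>n\<close> independent entries, each close to
  Gaussian up to the level \<open>sqrt (2 * ln n)\<close>. Cutting the coordinates into blocks of length about
  \<open>2 * (ln n)\<^sup>3\<close>, with one row of equal weights per block, does so (\<open>block_matrix_lower\<close>): the blocks are
  disjoint, so the entries are independent; a polylogarithmic length loses only a factor \<open>n powr o(1)\<close> in
  the number of entries; and it is long enough for the normalised sums to exceed a level \<open>t\<close> of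
  order \<open>sqrt (ln n)\<close> with probability \<open>exp (- (1 + o(1)) * t\<^sup>2 / 2)\<close>, which follows from ratios of binomial
  coefficients (\<open>sign_mean_sum_ge\<close>). At a level slightly below \<open>sqrt (2 * ln n)\<close> the expected number of
  entries above the level tends to infinity, and by independence the probability that there is none tends
  to 0.

  That the maximum over all matrices is attained is compactness (\<open>mean_linf_norm_attains_max\<close>). All
  probabilities are finite averages over sign assignments.\<close>

section \<open>Averages over sign assignments\<close>

text \<open>An average over the assignments \<open>I \<rightarrow> {-1, 1}\<close> is an expectation for independent uniform signs. An
  arbitrary index set \<open>I\<close>, rather than \<open>{..<n}\<close>, lets the restriction of the signs to a block of
  coordinates be averaged in the same way as all of them.\<close>
definition sign_mean :: "'a set \<Rightarrow> (('a \<Rightarrow> real) \<Rightarrow> real) \<Rightarrow> real" where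
  "sign_mean I f = (\<Sum>x\<in>I \<rightarrow>\<^sub>E {-1, 1}. f x) / 2 ^ card I"

lemma sign_mean_mono:
  assumes "\<And>x. x \<in> I \<rightarrow>\<^sub>E {-1, 1} \<Longrightarrow> f x \<le> g x"
  shows "sign_mean I f \<le> sign_mean I g"
  using assms by (auto simp: sign_mean_def intro!: divide_right_mono sum_mono)

lemma card_signs:
  "finite I \<Longrightarrow> card (I \<rightarrow>\<^sub>E {-1, 1 :: real}) = 2 ^ card I"
  by (simp add: card_PiE numeral_2_eq_2)

lemma sign_mean_const: "finite I \<Longrightarrow> sign_mean I (\<lambda>_. c) = c"
  by (simp add: sign_mean_def card_signs)

lemma sign_mean_add: "sign_mean I (\<lambda>x. f x + g x) = sign_mean I f + sign_mean I g"
  by (simp add: sign_mean_def sum.distrib add_divide_distrib)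

lemma sign_mean_diff: "sign_mean I (\<lambda>x. f x - g x) = sign_mean I f - sign_mean I g"
  by (simp add: sign_mean_def sum_subtractf diff_divide_distrib)

lemma sign_mean_cmult: "sign_mean I (\<lambda>x. c * f x) = c * sign_mean I f"
  by (simp add: sign_mean_def sum_distrib_left)

lemma sign_mean_sum: "sign_mean I (\<lambda>x. \<Sum>a\<in>A. f a x) = (\<Sum>a\<in>A. sign_mean I (f a))"
  unfolding sign_mean_def by (subst sum.swap) (simp add: sum_divide_distrib)

lemma sign_mean_prod:
  assumes "finite I"
  shows "sign_mean I (\<lambda>x. \<Prod>i\<in>I. g i (x i)) = (\<Prod>i\<in>I. (g i 1 + g i (-1)) / 2)"
proof -
  have "(\<Sum>x\<in>I \<rightarrow>\<^sub>E {-1, 1}. \<Prod>i\<in>I. g i (x i)) = (\<Prod>i\<in>I. \<Sum>s\<in>{-1, 1}. g i s)"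
    using assms by (intro prod_sum_PiE[symmetric]) auto
  then show ?thesis
    by (simp add: sign_mean_def prod_dividef add.commute)
qed

text \<open>The signs on disjoint sets are independent: an assignment on \<open>I \<union> J\<close> amounts to one on \<open>I\<close> and one
  on \<open>J\<close>.\<close>
lemma sign_mean_disjoint:
  assumes "finite I" "finite J" "I \<inter> J = {}"
  shows "sign_mean (I \<union> J) (\<lambda>x. f (restrict x I) * g (restrict x J)) =
         sign_mean I f * sign_mean J g"
proof -
  let ?S = "\<lambda>I. I \<rightarrow>\<^sub>E {-1, 1 :: real}"
  have "(\<Sum>x\<in>?S (I \<union> J). f (restrict x I) * g (restrict x J)) =
        (\<Sum>(y, z)\<in>?S I \<times> ?S J. f y * g z)"
  proof (rule sum.reindex_bij_witness[where
        i = "\<lambda>(y, z) i. if i \<in> I then y i else z i" and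
        j = "\<lambda>x. (restrict x I, restrict x J)"])
    show "(\<lambda>(y, z) i. if i \<in> I then y i else z i) p \<in> ?S (I \<union> J)"
      if "p \<in> ?S I \<times> ?S J" for p
      using that by (cases p) (auto simp: PiE_iff extensional_def)
    show "(restrict ((\<lambda>(y, z) i. if i \<in> I then y i else z i) p) I,
           restrict ((\<lambda>(y, z) i. if i \<in> I then y i else z i) p) J) = p"
      if "p \<in> ?S I \<times> ?S J" for p
      using that assms(3)
      by (cases p) (auto simp: fun_eq_iff PiE_iff extensional_def disjoint_iff)
  qed (auto simp: fun_eq_iff PiE_iff extensional_def)
  also have "\<dots> = (\<Sum>y\<in>?S I. f y) * (\<Sum>z\<in>?S J. g z)"
    by (simp add: sum_product sum.cartesian_product)
  finally show ?thesis
    using assms by (simp add: sign_mean_def card_Un_disjoint power_add)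
qed

text \<open>The blocks do not have to exhaust \<open>I\<close>. In the induction the first block is split off, and all other
  coordinates, those in no block included, form the index set for the remaining blocks.\<close>
lemma sign_mean_prod_blocks:
  assumes "finite B" "finite I" "\<And>b. b \<in> B \<Longrightarrow> J b \<subseteq> I" "disjoint_family_on J B"
  shows "sign_mean I (\<lambda>x. \<Prod>b\<in>B. f b (restrict x (J b))) = (\<Prod>b\<in>B. sign_mean (J b) (f b))"
  using assms
proof (induction B arbitrary: I rule: finite_induct)
  case empty
  then show ?case by (simp add: sign_mean_const)
next
  case (insert b B)
  define I' where "I' = I - J b"
  have sub: "J c \<subseteq> I'" if "c \<in> B" for c
    using insert.prems that insert.hyps by (auto simp: I'_def disjoint_family_on_def)
  have I: "I = J b \<union> I'" and fin: "finite (J b)" "finite I'"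
    using insert.prems by (auto simp: I'_def intro: finite_subset)
  have rr: "restrict (restrict x I') (J c) = restrict x (J c)" if "c \<in> B" for c and x :: "'b \<Rightarrow> real"
    using sub[OF that] by (simp add: Int_absorb1)
  have "sign_mean I (\<lambda>x. \<Prod>c\<in>insert b B. f c (restrict x (J c))) =
        sign_mean (J b \<union> I')
          (\<lambda>x. f b (restrict x (J b)) * (\<Prod>c\<in>B. f c (restrict (restrict x I') (J c))))"
    using insert.hyps by (simp add: I [symmetric] rr del: restrict_restrict cong: prod.cong)
  also have "\<dots> = sign_mean (J b) (f b) * sign_mean I' (\<lambda>x. \<Prod>c\<in>B. f c (restrict x (J c)))"
    by (rule sign_mean_disjoint[where g = "\<lambda>y. \<Prod>c\<in>B. f c (restrict y (J c))"])
       (use fin in \<open>auto simp: I'_def\<close>)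
  also have "\<dots> = (\<Prod>c\<in>insert b B. sign_mean (J c) (f c))"
    using insert.hyps insert.prems fin sub
    by (subst insert.IH) (auto simp: disjoint_family_on_def)
  finally show ?case .
qed

section \<open>The upper bound: exponential moments\<close>

text \<open>The quotient of both sides is antitone on the positive half line, because its derivative has the sign
  of \<open>sinh y - y * cosh y\<close>.\<close>
lemma cosh_le_exp_half_square: "cosh x \<le> exp (x\<^sup>2 / 2)" for x :: real
proof -
  have sinh_le: "sinh y \<le> y * cosh y" if "y \<ge> 0" for y :: real
    using DERIV_nonneg_imp_nondecreasing[of 0 y "\<lambda>y. y * cosh y - sinh y"] that
    by (force intro!: derivative_eq_intros)
  have "cosh y \<le> exp (y\<^sup>2 / 2)" if "y \<ge> 0" for y :: real
  proof -
    let ?h = "\<lambda>y :: real. exp (- (y\<^sup>2 / 2)) * cosh y"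
    have "?h y \<le> ?h 0"
    proof (rule DERIV_nonpos_imp_nonincreasing[OF that])
      fix z :: real assume "0 \<le> z"
      have "(?h has_real_derivative exp (- (z\<^sup>2 / 2)) * (sinh z - z * cosh z)) (at z)"
        by (auto intro!: derivative_eq_intros simp: algebra_simps)
      moreover have "exp (- (z\<^sup>2 / 2)) * (sinh z - z * cosh z) \<le> 0"
        using sinh_le[OF \<open>0 \<le> z\<close>] by (simp add: mult_nonneg_nonpos)
      ultimately show "\<exists>D. (?h has_real_derivative D) (at z) \<and> D \<le> 0"
        by blast
    qed
    then show ?thesis by (simp add: exp_minus field_simps)
  qed
  from this[of "\<bar>x\<bar>"] show ?thesis by (cases "x \<ge> 0") (auto simp: abs_if)
qed

text \<open>The sub-Gaussian bound: a sign sum whose squared weights add up to at most 1 has a moment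
  generating function no larger than that of a standard Gaussian.\<close>
lemma sign_mean_exp_le:
  assumes "finite I" "(\<Sum>i\<in>I. (a i)\<^sup>2) \<le> 1"
  shows "sign_mean I (\<lambda>x. exp (t * (\<Sum>i\<in>I. a i * x i))) \<le> exp (t\<^sup>2 / 2)"
proof -
  have "sign_mean I (\<lambda>x. exp (t * (\<Sum>i\<in>I. a i * x i))) =
        sign_mean I (\<lambda>x. \<Prod>i\<in>I. exp (t * a i * x i))"
    using assms by (simp add: exp_sum sum_distrib_left mult.assoc)
  also have "\<dots> = (\<Prod>i\<in>I. cosh (t * a i))"
    using assms by (subst sign_mean_prod) (auto simp: cosh_def)
  also have "\<dots> \<le> (\<Prod>i\<in>I. exp ((t * a i)\<^sup>2 / 2))"
    by (intro prod_mono) (auto intro: cosh_le_exp_half_square)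
  also have "\<dots> = exp (t\<^sup>2 / 2 * (\<Sum>i\<in>I. (a i)\<^sup>2))"
    using assms by (simp add: exp_sum sum_distrib_left power_mult_distrib)
  also have "\<dots> \<le> exp (t\<^sup>2 / 2)"
    using assms by (simp add: mult_left_le)
  finally show ?thesis .
qed

lemma mean_linf_norm_eq:
  assumes "A \<in> carrier_mat n n"
  shows "mean_linf_norm n A =
    sign_mean {..<n} (\<lambda>x. Max ((\<lambda>i. \<bar>\<Sum>j<n. A $$ (i, j) * x j\<bar>) ` {..<n}))"
proof -
  have "linf_norm (A *\<^sub>v vec n x) = Max ((\<lambda>i. \<bar>\<Sum>j<n. A $$ (i, j) * x j\<bar>) ` {..<n})" for x
    unfolding linf_norm_def
    using assms by (intro arg_cong[where f = Max] image_cong)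
      (auto simp: scalar_prod_def atLeast0LessThan intro!: arg_cong[where f = abs] sum.cong)
  then show ?thesis
    unfolding mean_linf_norm_def sign_mean_def
    by (subst sum.reindex_bij_betw[OF bij_betw_sign_vecs, symmetric]) simp
qed

lemma mem_row_bounded_mats:
  "A \<in> row_bounded_mats n \<longleftrightarrow> A \<in> carrier_mat n n \<and> (\<forall>i<n. (\<Sum>j<n. (A $$ (i, j))\<^sup>2) \<le> 1)"
  by (auto simp: row_bounded_mats_def l2_norm_def L2_set_def real_sqrt_le_1_iff)

text \<open>The maximum of \<open>n\<close> absolute values is the maximum of the \<open>2 n\<close> sign sums given by the rows and their
  negatives. Bounding the exponential of \<open>t\<close> times a maximum by the sum of the exponentials gives
  \<open>2 n * exp (t\<^sup>2 / 2)\<close> on average, and \<open>t = sqrt (2 * ln (2 * n))\<close> is the best choice. Since only the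
  tangent line of \<open>exp\<close> is needed to return from exponentials to \<open>t\<close> times the maximum, the usual appeal
  to Jensen's inequality becomes \<open>1 + y \<le> exp y\<close>.\<close>
lemma mean_linf_norm_upper:
  assumes "n \<ge> 1" "A \<in> row_bounded_mats n"
  shows "mean_linf_norm n A \<le> sqrt (2 * ln (2 * real n))"
proof -
  define t where "t = sqrt (2 * ln (2 * real n))"
  define r where "r i x = (\<Sum>j<n. A $$ (i, j) * x j)" for i :: nat and x :: "nat \<Rightarrow> real"
  define M where "M x = Max ((\<lambda>i. \<bar>r i x\<bar>) ` {..<n})" for x
  have A: "A \<in> carrier_mat n n" "\<And>i. i < n \<Longrightarrow> (\<Sum>j<n. (A $$ (i, j))\<^sup>2) \<le> 1"
    using assms by (auto simp: mem_row_bounded_mats)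
  have ln_pos: "ln (2 * real n) > 0" using assms by simp
  then have t: "t > 0" "t\<^sup>2 = 2 * ln (2 * real n)" by (auto simp: t_def)
  have exp_M: "exp (t * M x) \<le> (\<Sum>i<n. exp (t * r i x) + exp (- t * r i x))" for x
  proof -
    have "M x \<in> (\<lambda>i. \<bar>r i x\<bar>) ` {..<n}"
      unfolding M_def using assms by (intro Max_in) (auto simp: lessThan_empty_iff)
    then obtain i where i: "i < n" "M x = \<bar>r i x\<bar>" by auto
    then have "exp (t * M x) \<le> exp (t * r i x) + exp (- t * r i x)"
      by (cases "r i x \<ge> 0") auto
    also have "\<dots> \<le> (\<Sum>i<n. exp (t * r i x) + exp (- t * r i x))"
      using i by (intro member_le_sum) (auto intro: add_nonneg_nonneg)
    finally show ?thesis .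
  qed
  \<comment> \<open>The tangent is taken at \<open>t * M x = t\<^sup>2\<close>, as \<open>t\<^sup>2 = ln (2 n) + t\<^sup>2 / 2\<close> is the logarithm of the moment bound.\<close>
  have "1 + (t * sign_mean {..<n} M - t\<^sup>2) = sign_mean {..<n} (\<lambda>x. 1 + (t * M x - t\<^sup>2))"
    by (simp add: sign_mean_add sign_mean_diff sign_mean_cmult sign_mean_const)
  also have "\<dots> \<le> sign_mean {..<n} (\<lambda>x. exp (- (t\<^sup>2)) *
                    (\<Sum>i<n. exp (t * r i x) + exp (- t * r i x)))"
  proof (rule sign_mean_mono)
    fix x
    have "1 + (t * M x - t\<^sup>2) \<le> exp (t * M x - t\<^sup>2)" by (rule exp_ge_add_one_self)
    also have "\<dots> = exp (- (t\<^sup>2)) * exp (t * M x)" by (simp add: exp_diff exp_minus field_simps)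
    also have "\<dots> \<le> exp (- (t\<^sup>2)) * (\<Sum>i<n. exp (t * r i x) + exp (- t * r i x))"
      using exp_M by (intro mult_left_mono) auto
    finally show "1 + (t * M x - t\<^sup>2) \<le> \<dots>" .
  qed
  also have "\<dots> = exp (- (t\<^sup>2)) * (\<Sum>i<n. sign_mean {..<n} (\<lambda>x. exp (t * r i x)) +
                                   sign_mean {..<n} (\<lambda>x. exp (- t * r i x)))"
    by (simp only: sign_mean_cmult sign_mean_sum sign_mean_add)
  also have "\<dots> \<le> exp (- (t\<^sup>2)) * (\<Sum>i<n. exp (t\<^sup>2 / 2) + exp ((- t)\<^sup>2 / 2))"
    unfolding r_def using A
    by (intro mult_left_mono sum_mono add_mono sign_mean_exp_le) auto
  also have "\<dots> = 1"
  proof -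
    have half: "exp (t\<^sup>2 / 2) = 2 * real n" using assms t by simp
    have "exp (t\<^sup>2) = (exp (t\<^sup>2 / 2))\<^sup>2" by (simp flip: exp_double)
    then show ?thesis
      using assms half by (simp add: exp_minus field_simps power2_eq_square)
  qed
  finally have "t * sign_mean {..<n} M \<le> t * t" by (simp add: power2_eq_square)
  then have "sign_mean {..<n} M \<le> t" using t by simp
  then show ?thesis
    using mean_linf_norm_eq[OF A(1)] by (simp add: M_def[abs_def] r_def[abs_def] t_def)
qed

section \<open>Existence of a maximiser\<close>

lemma continuous_on_Max_image:
  fixes g :: "'i \<Rightarrow> 'a :: topological_space \<Rightarrow> real"
  assumes "finite I" "I \<noteq> {}" "\<And>i. i \<in> I \<Longrightarrow> continuous_on S (g i)"
  shows "continuous_on S (\<lambda>x. Max ((\<lambda>i. g i x) ` I))"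
  using assms
proof (induction I rule: finite_ne_induct)
  case (insert i I)
  then show ?case by (simp add: continuous_on_max)
qed simp

text \<open>Matrices are encoded as functions on \<open>nat \<times> nat\<close> with the product topology, where a cube is compact by Tychonoff's theorem; bounding every coordinate,
  also those outside the matrix, keeps the set of encodings compact.\<close>
lemma mean_linf_norm_attains_max:
  assumes "n \<ge> 1"
  obtains A where "A \<in> row_bounded_mats n"
    "\<And>B. B \<in> row_bounded_mats n \<Longrightarrow> mean_linf_norm n B \<le> mean_linf_norm n A"
proof -
  define K :: "(nat \<times> nat \<Rightarrow> real) set" where
    "K = (UNIV \<rightarrow>\<^sub>E {-1..1}) \<inter> (\<Inter>i\<in>{..<n}. {f. (\<Sum>j<n. (f (i, j))\<^sup>2) \<le> 1})"
  have coord: "continuous_on S (\<lambda>f :: nat \<times> nat \<Rightarrow> real. f p)" for p S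
    by (rule continuous_on_subset[OF continuous_on_product_coordinates]) simp
  have "compact ((UNIV \<rightarrow>\<^sub>E {-1..1}) :: (nat \<times> nat \<Rightarrow> real) set)"
    using compactin_PiE[where I = UNIV and X = "\<lambda>_. euclidean"
        and S = "\<lambda>_ :: nat \<times> nat. {-1..1 :: real}"]
    by (simp add: euclidean_product_topology)
  then have "compact K"
    unfolding K_def
    by (intro compact_Int_closed closed_INT ballI closed_Collect_le continuous_intros coord)
  moreover have "(\<lambda>_. 0) \<in> K" by (auto simp: K_def)
  moreover have "continuous_on K (\<lambda>f. mean_linf_norm n (mat n n f))"
  proof -
    have "continuous_on K (\<lambda>f. sign_mean {..<n}
            (\<lambda>x. Max ((\<lambda>i. \<bar>\<Sum>j<n. f (i, j) * x j\<bar>) ` {..<n})))"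
      unfolding sign_mean_def using assms
      by (intro continuous_intros continuous_on_Max_image coord) (auto simp: lessThan_empty_iff)
    then show ?thesis
      by (subst mean_linf_norm_eq) (auto cong: image_cong_simp)
  qed
  ultimately obtain f where f: "f \<in> K"
    "\<And>g. g \<in> K \<Longrightarrow> mean_linf_norm n (mat n n g) \<le> mean_linf_norm n (mat n n f)"
    using continuous_attains_sup[of K] by blast
  show ?thesis
  proof
    show "mat n n f \<in> row_bounded_mats n"
      using f(1) by (simp add: K_def mem_row_bounded_mats)
  next
    fix B assume B: "B \<in> row_bounded_mats n"
    define g where "g = (\<lambda>(i, j). if i < n \<and> j < n then B $$ (i, j) else 0)"
    have rows: "(\<Sum>j<n. (B $$ (i, j))\<^sup>2) \<le> 1" if "i < n" for i
      using B that by (simp add: mem_row_bounded_mats)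
    have "\<bar>B $$ (i, j)\<bar> \<le> 1" if "i < n" "j < n" for i j
    proof -
      have "(B $$ (i, j))\<^sup>2 \<le> (\<Sum>j<n. (B $$ (i, j))\<^sup>2)"
        using that by (intro member_le_sum) auto
      then show ?thesis using rows[OF that(1)] by (simp flip: abs_square_le_1)
    qed
    then have "g \<in> K"
      using rows by (fastforce simp: K_def g_def abs_le_iff)
    moreover have "mat n n g = B"
      using B by (auto simp: g_def mem_row_bounded_mats)
    ultimately show "mean_linf_norm n B \<le> mean_linf_norm n (mat n n f)"
      using f(2) by blast
  qed
qed

section \<open>The lower bound: independent blocks\<close>

text \<open>Consecutive binomial coefficients have the ratio \<open>(m - i) / (m + i + 1) = 1 / (1 + u)\<close> with
  \<open>u = (2 i + 1) / (m - i)\<close>, which is at least \<open>exp (- u)\<close>; the numerators of the exponents add up to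
  \<open>i\<^sup>2\<close>. The denominators \<open>m - i\<close> are bounded below by a common one, so that the induction closes; it is
  \<open>m (1 - o(1))\<close> when \<open>j = o(m)\<close>.\<close>
lemma central_binomial_ratio:
  assumes "i \<le> j" "j \<le> m"
  shows "real ((2 * m) choose m) * exp (- ((real i)\<^sup>2 / (real m - real j + 1)))
         \<le> real ((2 * m) choose (m + i))"
  using assms(1)
proof (induction i)
  case 0
  then show ?case by simp
next
  case (Suc i)
  define D where "D = real m - real j + 1"
  have D: "D > 0" "D \<le> real m - real i" and i: "i < m" using Suc.prems assms by (auto simp: D_def)
  let ?u = "(2 * real i + 1) / (real m - real i)"
  have "(m + i + 1) * ((2 * m) choose (m + Suc i)) = (m - i) * ((2 * m) choose (m + i))"
    using binomial_absorption[of "m + i" "2 * m"] binomial_absorb_comp[of "2 * m" "m + i"] i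
    by (simp add: mult_2)
  then have "real (m + i + 1) * real ((2 * m) choose (m + Suc i)) =
      real (m - i) * real ((2 * m) choose (m + i))"
    by (metis of_nat_mult)
  then have step: "real ((2 * m) choose (m + Suc i)) = real ((2 * m) choose (m + i)) / (1 + ?u)"
    using i by (simp add: of_nat_diff field_simps)
  have pos: "1 + ?u > 0" using i by (intro add_pos_nonneg) auto
  have "real ((2 * m) choose m) * exp (- ((real (Suc i))\<^sup>2 / D)) =
        real ((2 * m) choose m) * exp (- ((real i)\<^sup>2 / D)) * exp (- ((2 * real i + 1) / D))"
    using D by (simp add: mult_exp_exp power2_eq_square field_simps)
  also have "\<dots> \<le> real ((2 * m) choose (m + i)) * exp (- ?u)"
    using Suc D i unfolding D_def[symmetric]
    by (intro mult_mono) (auto intro!: divide_left_mono mult_pos_pos)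
  also have "\<dots> \<le> real ((2 * m) choose (m + i)) / (1 + ?u)"
  proof -
    have "exp (- ?u) \<le> 1 / (1 + ?u)"
      using exp_ge_add_one_self[of ?u] pos
      by (simp only: exp_minus inverse_eq_divide) (intro divide_left_mono mult_pos_pos; simp)
    then show ?thesis
      using mult_left_mono[of "exp (- ?u)" "1 / (1 + ?u)" "real ((2 * m) choose (m + i))"] by simp
  qed
  finally show ?case using step by (simp add: D_def)
qed

text \<open>Only the sign vectors with exactly \<open>m + j\<close> positive entries are counted, whose sum equals \<open>2 j\<close>.\<close>
lemma sign_mean_sum_ge_binomial:
  assumes "finite I" "card I = 2 * m" "j \<le> m"
  shows "real ((2 * m) choose (m + j)) / 4 ^ m \<le>
         sign_mean I (\<lambda>x. of_bool (2 * real j \<le> (\<Sum>i\<in>I. x i)))"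
proof -
  define F :: "'a set \<Rightarrow> 'a \<Rightarrow> real" where "F T = (\<lambda>i\<in>I. if i \<in> T then 1 else -1)" for T
  define \<T> where "\<T> = {T. T \<subseteq> I \<and> card T = m + j}"
  define X where "X = (I \<rightarrow>\<^sub>E {-1, 1}) \<inter> {x. 2 * real j \<le> (\<Sum>i\<in>I. x i)}"
  have "F T \<in> X" if "T \<in> \<T>" for T
  proof -
    have T: "T \<subseteq> I" "card T = m + j" "finite T"
      using that assms by (auto simp: \<T>_def intro: finite_subset)
    have "(\<Sum>i\<in>I. F T i) = (\<Sum>i\<in>I. 2 * of_bool (i \<in> T) - 1)"
      by (intro sum.cong) (auto simp: F_def)
    also have "\<dots> = 2 * real (card T) - real (card I)"
      using assms T by (simp add: sum_subtractf sum_of_bool_eq Int_absorb1 flip: sum_distrib_left)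
    finally show ?thesis
      using assms T by (auto simp: X_def F_def)
  qed
  moreover have "inj_on F \<T>"
  proof (rule inj_onI)
    fix S T assume *: "S \<in> \<T>" "T \<in> \<T>" "F S = F T"
    have "i \<in> S \<longleftrightarrow> i \<in> T" if "i \<in> I" for i
      using fun_cong[OF *(3), of i] that by (auto simp: F_def split: if_splits)
    then show "S = T" using * by (auto simp: \<T>_def)
  qed
  moreover have "finite X" using assms by (simp add: X_def finite_PiE)
  ultimately have "card \<T> \<le> card X" by (intro card_inj_on_le[of F]) auto
  then have "(2 * m) choose (m + j) \<le> card X"
    using assms n_subsets[of I "m + j"] by (simp add: \<T>_def)
  then show ?thesis
    using assms by (simp add: sign_mean_def X_def sum_of_bool_eq finite_PiE power_mult divide_right_mono)
qed

text \<open>A Gaussian lower tail bound: at the level \<open>2 j = t * sqrt (2 m)\<close> the exponent is \<open>t\<^sup>2 / 2\<close> up to a factor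
  \<open>1 + o(1)\<close>, provided that \<open>j = o(m)\<close>. The lost factor \<open>1 / (2 m)\<close> is harmless since \<open>m\<close> will be a power
  of \<open>ln n\<close>.\<close>
lemma sign_mean_sum_ge:
  assumes "finite I" "card I = 2 * m" "j \<le> m" "m \<ge> 1"
  shows "exp (- ((real j)\<^sup>2 / (real m - real j + 1))) / (2 * real m) \<le>
         sign_mean I (\<lambda>x. of_bool (2 * real j \<le> (\<Sum>i\<in>I. x i)))"
proof -
  have "4 ^ m * (exp (- ((real j)\<^sup>2 / (real m - real j + 1))) / (2 * real m)) =
        4 ^ m / (2 * real m) * exp (- ((real j)\<^sup>2 / (real m - real j + 1)))" by simp
  also have "\<dots> \<le> real ((2 * m) choose m) * exp (- ((real j)\<^sup>2 / (real m - real j + 1)))"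
    using central_binomial_lower_bound[of m] assms by (intro mult_right_mono) auto
  also have "\<dots> \<le> real ((2 * m) choose (m + j))"
    using assms by (intro central_binomial_ratio) auto
  finally have "exp (- ((real j)\<^sup>2 / (real m - real j + 1))) / (2 * real m) \<le>
      real ((2 * m) choose (m + j)) / 4 ^ m" by (simp add: field_simps)
  also note sign_mean_sum_ge_binomial[OF assms(1-3)]
  finally show ?thesis .
qed

text \<open>The first \<open>N\<close> rows of the matrix are supported on disjoint blocks of \<open>2 m\<close> coordinates and constant
  there; the other rows vanish. Hence the first \<open>N\<close> entries of \<open>A x\<close> are independent normalised sign sums, each of
  which reaches \<open>2 j / sqrt (2 m)\<close> with probability at least \<open>p\<close>, and all \<open>N\<close> of them miss this level with
  probability at most \<open>(1 - p) ^ N \<le> exp (- N p)\<close>.\<close>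
lemma block_matrix_lower:
  assumes "m \<ge> 1" "j \<le> m" "2 * m * N \<le> n" "n \<ge> 1"
  defines "p \<equiv> exp (- ((real j)\<^sup>2 / (real m - real j + 1))) / (2 * real m)"
  obtains A where "A \<in> row_bounded_mats n"
    "2 * real j / sqrt (2 * real m) * (1 - exp (- (real N * p))) \<le> mean_linf_norm n A"
proof -
  define k where "k = 2 * m"
  define J where "J b = {b * k..<Suc b * k}" for b
  define A where "A = mat n n (\<lambda>(i, c). if i < N \<and> c \<in> J i then 1 / sqrt (real k) else 0)"
  define t where "t = 2 * real j / sqrt (real k)"
  define fail :: "nat \<Rightarrow> (nat \<Rightarrow> real) \<Rightarrow> real" where
    "fail b x = of_bool (\<not> 2 * real j \<le> (\<Sum>c\<in>J b. x c))" for b x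
  have k: "k \<ge> 1" and kN: "N * k \<le> n" using assms by (auto simp: k_def mult.commute)
  have "N * 1 \<le> N * k" using k by (intro mult_le_mono) auto
  then have Nn: "N \<le> n" using kN by linarith
  have J: "J b \<subseteq> {..<n}" if "b < N" for b
  proof -
    have "Suc b * k \<le> N * k" using that by (intro mult_le_mono) auto
    then have "Suc b * k \<le> n" using kN by (rule order_trans)
    then show ?thesis by (auto simp: J_def simp del: mult_Suc)
  qed
  have card_J: "finite (J b)" "card (J b) = k" for b by (auto simp: J_def)
  have disj: "disjoint_family_on J {..<N}"
  proof -
    have div: "c div k = b" if "c \<in> J b" for b c
      using that k by (intro div_nat_eqI) (auto simp: J_def mult.commute)
    show ?thesis unfolding disjoint_family_on_def using div by blast
  qed
  have A_carrier: "A \<in> carrier_mat n n" by (simp add: A_def)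
  have row_sum: "(\<Sum>c<n. A $$ (i, c) * x c) = (\<Sum>c\<in>J i. x c) / sqrt (real k)" if "i < N" for i x
  proof -
    have "(\<Sum>c<n. A $$ (i, c) * x c) = (\<Sum>c\<in>J i. A $$ (i, c) * x c)"
      using J[OF that] that Nn by (intro sum.mono_neutral_right) (auto simp: A_def)
    also have "\<dots> = (\<Sum>c\<in>J i. x c / sqrt (real k))"
      using J[OF that] that Nn by (intro sum.cong) (auto simp: A_def)
    finally show ?thesis by (simp add: sum_divide_distrib)
  qed
  have "A \<in> row_bounded_mats n"
    unfolding mem_row_bounded_mats
  proof (intro conjI allI impI A_carrier)
    fix i assume i: "i < n"
    have "(\<Sum>c<n. (A $$ (i, c))\<^sup>2) \<le> (\<Sum>c<n. of_bool (c \<in> J i) / real k)"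
      using i by (intro sum_mono) (auto simp: A_def power_divide)
    also have "\<dots> = real (card ({..<n} \<inter> J i)) / real k"
      by (simp add: sum_of_bool_eq flip: sum_divide_distrib)
    also have "card ({..<n} \<inter> J i) \<le> k"
      using card_mono[of "J i" "{..<n} \<inter> J i"] card_J[of i] by auto
    then have "real (card ({..<n} \<inter> J i)) / real k \<le> 1" using k by simp
    finally show "(\<Sum>c<n. (A $$ (i, c))\<^sup>2) \<le> 1" .
  qed
  moreover have "t * (1 - exp (- (real N * p))) \<le> mean_linf_norm n A"
  proof -
    have fail_mean: "sign_mean (J b) (fail b) \<le> 1 - p" for b
    proof -
      have "fail b = (\<lambda>x. 1 - of_bool (2 * real j \<le> (\<Sum>c\<in>J b. x c)))"
        by (auto simp: fail_def fun_eq_iff)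
      then show ?thesis
        using sign_mean_sum_ge[of "J b" m j] assms card_J[of b]
        by (simp add: sign_mean_diff sign_mean_const p_def k_def)
    qed
    have nonneg: "sign_mean (J b) (fail b) \<ge> 0" for b
      by (auto simp: sign_mean_def fail_def intro!: divide_nonneg_nonneg sum_nonneg)
    have fail_restrict: "fail b (restrict x (J b)) = fail b x" for b x
      by (simp add: fail_def)
    have "sign_mean {..<n} (\<lambda>x. \<Prod>b<N. fail b x) = (\<Prod>b<N. sign_mean (J b) (fail b))"
      using sign_mean_prod_blocks[of "{..<N}" "{..<n}" J fail] J disj
      by (simp add: fail_restrict)
    also have "\<dots> \<le> (\<Prod>b<N. exp (- p))"
      using fail_mean nonneg exp_ge_add_one_self[of "- p"]
      by (intro prod_mono) (auto intro: order_trans)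
    also have "\<dots> = exp (- (real N * p))" by (simp flip: exp_of_nat_mult)
    finally have all_fail: "sign_mean {..<n} (\<lambda>x. \<Prod>b<N. fail b x) \<le> exp (- (real N * p))" .
    have t: "t \<ge> 0" by (simp add: t_def)
    have "t * (1 - exp (- (real N * p))) \<le> t * (1 - sign_mean {..<n} (\<lambda>x. \<Prod>b<N. fail b x))"
      using all_fail t by (intro mult_left_mono) auto
    also have "\<dots> = sign_mean {..<n} (\<lambda>x. t * (1 - (\<Prod>b<N. fail b x)))"
      by (simp add: sign_mean_cmult sign_mean_diff sign_mean_const)
    also have "\<dots> \<le> sign_mean {..<n} (\<lambda>x. Max ((\<lambda>i. \<bar>\<Sum>c<n. A $$ (i, c) * x c\<bar>) ` {..<n}))"
    proof (rule sign_mean_mono)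
      fix x
      let ?M = "Max ((\<lambda>i. \<bar>\<Sum>c<n. A $$ (i, c) * x c\<bar>) ` {..<n})"
      have ge: "\<bar>\<Sum>c<n. A $$ (i, c) * x c\<bar> \<le> ?M" if "i < n" for i
        using that by (intro Max_ge) auto
      show "t * (1 - (\<Prod>b<N. fail b x)) \<le> ?M"
      proof (cases "\<exists>b<N. 2 * real j \<le> (\<Sum>c\<in>J b. x c)")
        case True
        then obtain b where b: "b < N" "2 * real j \<le> (\<Sum>c\<in>J b. x c)" by blast
        have "(\<Prod>b<N. fail b x) = 0"
          using b by (auto simp: fail_def intro!: prod_zero)
        then have "t * (1 - (\<Prod>b<N. fail b x)) = t" by simp
        also have "t \<le> (\<Sum>c\<in>J b. x c) / sqrt (real k)"
          using b by (auto simp: t_def intro!: divide_right_mono)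
        also have "\<dots> \<le> ?M" using ge[of b] b Nn by (simp add: row_sum)
        finally show ?thesis .
      next
        case False
        then have "(\<Prod>b<N. fail b x) = 1"
          by (intro prod.neutral) (auto simp: fail_def)
        moreover have "0 \<le> ?M"
          using order_trans[OF abs_ge_zero ge[of 0]] assms(4) by simp
        ultimately show ?thesis by simp
      qed
    qed
    also have "\<dots> = mean_linf_norm n A"
      by (rule mean_linf_norm_eq[OF A_carrier, symmetric])
    finally show ?thesis .
  qed
  ultimately show ?thesis using that by (simp add: t_def k_def)
qed

section \<open>Choice of the block size and the limit\<close>

text \<open>A lower estimate for \<open>N * p\<close>, the number of blocks times the probability bound in
  \<open>block_matrix_lower\<close>, for the parameters chosen below. With \<open>s = sqrt (ln n)\<close> the exponent is about
  \<open>s\<^sup>2 - 2 * s\<close>, so that \<open>n\<close> times the exponential is about \<open>exp (2 * s)\<close>, which beats the powers of \<open>ln n\<close>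
  in the denominators.\<close>
definition expected_hits :: "real \<Rightarrow> real" where
  "expected_hits n = (n / (2 * (ln n ^ 3 + 1)) - 1) / (2 * (ln n ^ 3 + 1)) *
     exp (- ((sqrt (ln n) - 1) * ln n / (sqrt (ln n) + 1)))"

text \<open>With \<open>s = sqrt (ln n)\<close>, the choice \<open>j = sqrt m * (s - 1)\<close> up to rounding puts the level
  \<open>2 j / sqrt (2 m)\<close> near \<open>sqrt 2 * (s - 1)\<close>. The half-length \<open>m = s ^ 6 = (ln n)\<^sup>3\<close> makes \<open>j / m \<le> 1 / s\<^sup>2\<close>, so the
  correction factor in the tail exponent is at most \<open>1 / (1 - 1 / s\<^sup>2)\<close>, and it still leaves \<open>n\<close> divided by a
  power of \<open>ln n\<close> as the number of blocks.\<close>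
lemma block_matrix_lower_explicit:
  assumes "ln (real n) \<ge> 4"
  obtains A where "A \<in> row_bounded_mats n"
    "sqrt 2 * (sqrt (ln (real n)) - 2) * (1 - exp (- expected_hits (real n))) \<le> mean_linf_norm n A"
proof -
  define s where "s = sqrt (ln (real n))"
  define m where "m = nat \<lceil>s ^ 6\<rceil>"
  define j where "j = nat \<lfloor>sqrt (real m) * (s - 1)\<rfloor>"
  define N where "N = n div (2 * m)"
  have n: "n \<ge> 1" using assms by (cases n) auto
  have s: "s \<ge> 2" "s\<^sup>2 = ln (real n)"
    using assms real_le_rsqrt[of 2 "ln (real n)"] by (auto simp: s_def)
  have s6: "s ^ 6 = ln (real n) ^ 3" unfolding s(2)[symmetric] by (simp flip: power_mult)
  have m_bounds: "s ^ 6 \<le> real m" "real m \<le> s ^ 6 + 1" using s by (auto simp: m_def)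
  have s3: "s ^ 3 \<le> sqrt (real m)"
    using m_bounds(1) by (intro real_le_rsqrt) (simp flip: power_mult)
  have "1 \<le> s ^ 3" using s by simp
  then have rm: "1 \<le> sqrt (real m)" using s3 by linarith
  then have m: "m \<ge> 1" by (cases m) auto
  define r where "r = sqrt (real m)"
  have r: "r \<ge> 1" "r\<^sup>2 = real m" "s ^ 3 \<le> r" using rm s3 by (auto simp: r_def)
  have j_le: "real j \<le> r * (s - 1)" and j_ge: "real j \<ge> r * (s - 1) - 1"
    using s r by (auto simp: j_def r_def)
  have j_le': "real j \<le> real m / s\<^sup>2"
  proof -
    have "real j \<le> r * s" using j_le r by (simp add: algebra_simps)
    also have "\<dots> = r * s ^ 3 / s\<^sup>2" using s(1) by (simp add: power2_eq_square power3_eq_cube)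
    also have "\<dots> \<le> r * r / s\<^sup>2"
      using r by (intro divide_right_mono mult_left_mono) auto
    finally show ?thesis using r by (simp add: power2_eq_square)
  qed
  also have "\<dots> \<le> real m / 1"
    using s(1) by (intro divide_left_mono) (auto simp: one_le_power)
  finally have jm: "j \<le> m" by simp
  define p where "p = exp (- ((real j)\<^sup>2 / (real m - real j + 1))) / (2 * real m)"
  obtain A where A: "A \<in> row_bounded_mats n"
    "2 * real j / sqrt (2 * real m) * (1 - exp (- (real N * p))) \<le> mean_linf_norm n A"
    using block_matrix_lower[OF m jm _ n, of N] unfolding p_def N_def by auto
  have exponent: "(real j)\<^sup>2 / (real m - real j + 1) \<le> (s - 1) * s\<^sup>2 / (s + 1)"
  proof -
    have pos: "real m * (1 - 1 / s\<^sup>2) > 0"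
      using m s(1) one_less_power[of s 2] by (intro mult_pos_pos) auto
    have "(real j)\<^sup>2 / (real m - real j + 1) \<le> (r * (s - 1))\<^sup>2 / (real m * (1 - 1 / s\<^sup>2))"
      using j_le j_le' pos by (intro frac_le power_mono) (auto simp: algebra_simps)
    also have "\<dots> = (s - 1)\<^sup>2 / (1 - 1 / s\<^sup>2)"
      using m by (simp add: power_mult_distrib r)
    also have "1 - 1 / s\<^sup>2 = (s - 1) * (s + 1) / s\<^sup>2"
      using s(1) by (simp add: field_simps power2_eq_square)
    also have "(s - 1)\<^sup>2 / \<dots> = (s - 1) * s\<^sup>2 / (s + 1)"
      using s(1) by (simp add: power2_eq_square)
    finally show ?thesis .
  qed
  have N_ge: "real n / (2 * real m) - 1 \<le> real N"
  proof -
    have "\<lfloor>real n / real (2 * m)\<rfloor> = int N" by (simp only: N_def floor_divide_of_nat_eq)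
    then show ?thesis using real_of_int_floor_gt_diff_one[of "real n / real (2 * m)"] by simp
  qed
  have "expected_hits (real n) \<le> real N * p"
  proof -
    have "expected_hits (real n) = (real n / (2 * (s ^ 6 + 1)) - 1) / (2 * (s ^ 6 + 1)) *
            exp (- ((s - 1) * s\<^sup>2 / (s + 1)))"
      unfolding expected_hits_def s6 s(2) by (simp add: s_def)
    also have "\<dots> \<le> real N / (2 * (s ^ 6 + 1)) * exp (- ((s - 1) * s\<^sup>2 / (s + 1)))"
    proof (intro mult_right_mono divide_right_mono)
      have "real n / (2 * (s ^ 6 + 1)) \<le> real n / (2 * real m)"
        using m m_bounds by (intro divide_left_mono mult_pos_pos) auto
      then show "real n / (2 * (s ^ 6 + 1)) - 1 \<le> real N" using N_ge by linarith
    qed (use s in auto)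
    also have "\<dots> \<le> real N / (2 * real m) * exp (- ((real j)\<^sup>2 / (real m - real j + 1)))"
      using m m_bounds exponent by (intro mult_mono divide_left_mono mult_pos_pos) auto
    finally show ?thesis by (simp add: p_def)
  qed
  moreover have "sqrt 2 * (s - 2) \<le> 2 * real j / sqrt (2 * real m)"
  proof -
    have "(s - 2) * r \<le> real j"
      using j_ge r(1) by (simp add: algebra_simps)
    then have "sqrt 2 * (s - 2) * r \<le> sqrt 2 * real j"
      using mult_left_mono[of "(s - 2) * r" "real j" "sqrt 2"] by (simp add: mult.assoc)
    then have "sqrt 2 * (s - 2) \<le> sqrt 2 * real j / r" using r by (simp add: field_simps)
    also have "\<dots> = 2 * real j / sqrt (2 * real m)"
      using r by (simp add: real_sqrt_mult r_def field_simps)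
    finally show ?thesis .
  qed
  moreover have "real N * p \<ge> 0" by (simp add: p_def)
  ultimately have "sqrt 2 * (s - 2) * (1 - exp (- expected_hits (real n))) \<le>
      2 * real j / sqrt (2 * real m) * (1 - exp (- (real N * p)))"
    using s by (intro order_trans[OF mult_left_mono mult_right_mono]) auto
  then show ?thesis using A that unfolding s_def by (meson order_trans)
qed

theorem mainTheorem1:
  shows "(\<forall>n\<ge>1. \<exists>A\<in>row_bounded_mats n. \<forall>B\<in>row_bounded_mats n.
            mean_linf_norm n B \<le> mean_linf_norm n A) \<and>
         (\<lambda>n::nat. (GREATEST m. m \<in> mean_linf_norm n ` row_bounded_mats n) / sqrt (2 * ln (real n)))
           \<longlonglongrightarrow> 1"
proof
  show "\<forall>n\<ge>1. \<exists>A\<in>row_bounded_mats n. \<forall>B\<in>row_bounded_mats n.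
            mean_linf_norm n B \<le> mean_linf_norm n A"
    using mean_linf_norm_attains_max by metis
next
  define G where "G n = (GREATEST m. m \<in> mean_linf_norm n ` row_bounded_mats n)" for n
  have G: "G n \<in> mean_linf_norm n ` row_bounded_mats n"
    "A \<in> row_bounded_mats n \<Longrightarrow> mean_linf_norm n A \<le> G n" if n: "n \<ge> 1" for n A
  proof -
    obtain B where B: "B \<in> row_bounded_mats n"
      "\<And>C. C \<in> row_bounded_mats n \<Longrightarrow> mean_linf_norm n C \<le> mean_linf_norm n B"
      using mean_linf_norm_attains_max[OF n] by blast
    have "G n = mean_linf_norm n B"
      unfolding G_def using B by (intro Greatest_equality) auto
    then show "G n \<in> mean_linf_norm n ` row_bounded_mats n"
      "A \<in> row_bounded_mats n \<Longrightarrow> mean_linf_norm n A \<le> G n"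
      using B by auto
  qed
  show "(\<lambda>n. G n / sqrt (2 * ln (real n))) \<longlonglongrightarrow> 1"
  proof (rule tendsto_sandwich)
    have "(\<lambda>n. (sqrt (ln (real n)) - 2) * (1 - exp (- expected_hits (real n))) /
                sqrt (ln (real n))) \<longlonglongrightarrow> 1"
      unfolding expected_hits_def by real_asymp
    then show "(\<lambda>n. sqrt 2 * (sqrt (ln (real n)) - 2) * (1 - exp (- expected_hits (real n))) /
                sqrt (2 * ln (real n))) \<longlonglongrightarrow> 1"
      by (simp add: real_sqrt_mult)
    have "(\<lambda>n. sqrt (ln (2 * real n)) / sqrt (ln (real n))) \<longlonglongrightarrow> 1"
      by real_asymp
    then show "(\<lambda>n. sqrt (2 * ln (2 * real n)) / sqrt (2 * ln (real n))) \<longlonglongrightarrow> 1"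
      by (simp add: real_sqrt_mult)
    show "\<forall>\<^sub>F n in sequentially. G n / sqrt (2 * ln (real n)) \<le>
            sqrt (2 * ln (2 * real n)) / sqrt (2 * ln (real n))"
      using eventually_ge_at_top[of 1]
    proof eventually_elim
      case (elim n)
      then show ?case
        using G(1)[OF elim] mean_linf_norm_upper[OF elim]
        by (auto intro!: divide_right_mono)
    qed
    have "\<forall>\<^sub>F n in sequentially. ln (real n) \<ge> 4" by real_asymp
    then show "\<forall>\<^sub>F n in sequentially.
        sqrt 2 * (sqrt (ln (real n)) - 2) * (1 - exp (- expected_hits (real n))) /
          sqrt (2 * ln (real n)) \<le> G n / sqrt (2 * ln (real n))"
      using eventually_ge_at_top[of 1]
    proof eventually_elim
      case (elim n)
      obtain A where "A \<in> row_bounded_mats n"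
        "sqrt 2 * (sqrt (ln (real n)) - 2) * (1 - exp (- expected_hits (real n)))
           \<le> mean_linf_norm n A"
        using block_matrix_lower_explicit[OF elim(1)] by blast
      then show ?case
        using G(2)[OF elim(2)] elim by (intro divide_right_mono) (auto intro: order_trans)
    qed
  qed
qed

end
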